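(* The conifold algebra $\Lambda_c$ is isomorphic to the Clifford algebra of a non-degenerate ternary quadratic form over the polynomial ring $\mathbb{C}[x,y,z]$.
   Context: The conifold algebra is $$\Lambda_c=\frac{\mathbb{C}\langle X,Y,Z\rangle}{(Z^2-1,\ XZ+ZX,\ YZ+ZY,\ [X^2,Y],\ [Y^2,X])},\qquad [A,B]=AB-BA.$$ If $C$ is a commutative $\mathbb{C}$-algebra and $M_q$ is a symmetric $m\times m$ matrix over $C$, then $B_q(v,w)=v^{\tau}M_q w$ is a symmetric bilinear form on the free module $V=C^m$, and the associated Clifford algebra is $$Cl_q(V)=\frac{T_C(V)}{(v\otimes w+w\otimes v-2B_q(v,w)\ :\ v,w\in V)},$$ where $T_C(V)$ is the tensor algebra. The form is ternary if $m=3$; for $C$ a domain it is called non-degenerate if $\det M_q\neq0$ (i.e. the form is non-degenerate over the field of fractions of $C$). *)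

theory Defs
  imports
    "HOL-Analysis.Analysis"
    "HOL-Algebra.Algebraic_Closure_Type"
    "HOL-Library.Poly_Mapping"
begin

no_notation fps_nth (infixl "$" 75)

section \<open>Free algebras\<close>

text \<open>
  The free monoid, written additively, so that the convolution product of
  \<^theory>\<open>HOL-Library.Poly_Mapping\<close> makes \<open>'x word \<Rightarrow>\<^sub>0 'r\<close> the monoid algebra of the
  free monoid over \<open>'r\<close>, i.e. the free associative unital \<open>'r\<close>-algebra on the set \<open>'x\<close>.
\<close>

datatype 'x word = Word (letters: "'x list")

instantiation word :: (type) monoid_add
begin

definition zero_word :: "'a word" where
  "0 = Word []"

definition plus_word :: "'a word \<Rightarrow> 'a word \<Rightarrow> 'a word" where
  "u + w = Word (letters u @ letters w)"

instance
  by standard (simp_all add: zero_word_def plus_word_def)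

end

type_synonym ('r, 'x) free_algebra = "'x word \<Rightarrow>\<^sub>0 'r"

definition gen :: "'x \<Rightarrow> ('r::comm_ring_1, 'x) free_algebra" where
  "gen x = Poly_Mapping.single (Word [x]) 1"

text \<open>
  Structure map of a monoid algebra; used both for free algebras and for polynomial rings
  \<open>('v \<Rightarrow>\<^sub>0 nat) \<Rightarrow>\<^sub>0 'r\<close>.
\<close>

definition alg_const :: "'r::comm_ring_1 \<Rightarrow> ('m::monoid_add \<Rightarrow>\<^sub>0 'r)" where
  "alg_const r = Poly_Mapping.single 0 r"


section \<open>Quotients by generated two-sided ideals\<close>

text \<open>\<^const>\<open>genideal\<close> generates two-sided ideals, also in noncommutative rings.\<close>

definition quot_ring :: "('a, 'b) ring_scheme \<Rightarrow> 'a set \<Rightarrow> 'a set ring" where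
  "quot_ring R S = R Quot (Idl\<^bsub>R\<^esub> S)"

definition quot_class :: "('a, 'b) ring_scheme \<Rightarrow> 'a set \<Rightarrow> 'a \<Rightarrow> 'a set" where
  "quot_class R S a = (Idl\<^bsub>R\<^esub> S) +>\<^bsub>R\<^esub> a"


section \<open>Algebra isomorphism\<close>

text \<open>
  A \<open>'k\<close>-algebra is given by a ring together with its structure map from \<open>'k\<close>; an isomorphism
  of algebras is a ring isomorphism compatible with the structure maps.
\<close>

definition algebra_isomorphic ::
  "('a, 'c) ring_scheme \<Rightarrow> ('k \<Rightarrow> 'a) \<Rightarrow> ('b, 'd) ring_scheme \<Rightarrow> ('k \<Rightarrow> 'b) \<Rightarrow> bool" where
  "algebra_isomorphic A \<alpha> B \<beta> \<longleftrightarrow> (\<exists>f \<in> ring_iso A B. \<forall>k. f (\<alpha> k) = \<beta> k)"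


section \<open>The conifold algebra\<close>

datatype conifold_gen = GX | GY | GZ

definition commutator :: "'a::ring_1 \<Rightarrow> 'a \<Rightarrow> 'a" where
  "commutator a b = a * b - b * a"

definition conifold_relations :: "(complex, conifold_gen) free_algebra set" where
  "conifold_relations =
    (let x = gen GX; y = gen GY; z = gen GZ in
      {z\<^sup>2 - 1, x * z + z * x, y * z + z * y, commutator (x\<^sup>2) y, commutator (y\<^sup>2) x})"

definition conifold_algebra :: "(complex, conifold_gen) free_algebra set ring" where
  "conifold_algebra = quot_ring ring_of_type_algebra conifold_relations"

definition conifold_scalar :: "complex \<Rightarrow> (complex, conifold_gen) free_algebra set" where
  "conifold_scalar c = quot_class ring_of_type_algebra conifold_relations (alg_const c)"


section \<open>Tensor algebras and Clifford algebras\<close>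

text \<open>
  The tensor algebra of the free module \<open>'r^'m\<close>, independently of a basis: the free algebra on
  the underlying set of \<open>'r^'m\<close>, whose words of length \<open>n\<close> are the formal products
  \<open>v\<^sub>1 \<otimes> \<dots> \<otimes> v\<^sub>n\<close>, modulo linearity of the generators in \<open>v\<close>. The relations
  generate in each degree exactly the multilinear relations defining the tensor power.
\<close>

definition tensor_relations :: "('r::comm_ring_1, 'r^'m) free_algebra set" where
  "tensor_relations =
    {gen (v + w) - gen v - gen w | v w. True} \<union> {gen (r *s v) - alg_const r * gen v | r v. True}"

definition tensor_algebra :: "('r::comm_ring_1, 'r^'m) free_algebra set ring" where
  "tensor_algebra = quot_ring ring_of_type_algebra tensor_relations"

definition tensor_vec :: "'r::comm_ring_1^'m \<Rightarrow> ('r, 'r^'m) free_algebra set" where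
  "tensor_vec v = quot_class ring_of_type_algebra tensor_relations (gen v)"

definition tensor_scalar :: "'r::comm_ring_1 \<Rightarrow> ('r, 'r^'m) free_algebra set" where
  "tensor_scalar r = quot_class ring_of_type_algebra tensor_relations (alg_const r)"

definition bilin_form :: "'r::comm_ring_1^'m^'m \<Rightarrow> 'r^'m \<Rightarrow> 'r^'m \<Rightarrow> 'r" where
  "bilin_form M v w = (\<Sum>i\<in>UNIV. v $ i * (M *v w) $ i)"

definition clifford_relations ::
  "'r::comm_ring_1^'m^'m \<Rightarrow> ('r, 'r^'m) free_algebra set set" where
  "clifford_relations M =
    {(tensor_vec v \<otimes>\<^bsub>tensor_algebra\<^esub> tensor_vec w
        \<oplus>\<^bsub>tensor_algebra\<^esub> tensor_vec w \<otimes>\<^bsub>tensor_algebra\<^esub> tensor_vec v)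
      \<ominus>\<^bsub>tensor_algebra\<^esub> tensor_scalar (2 * bilin_form M v w) | v w. True}"

definition clifford_algebra ::
  "'r::comm_ring_1^'m^'m \<Rightarrow> ('r, 'r^'m) free_algebra set set ring" where
  "clifford_algebra M = quot_ring tensor_algebra (clifford_relations M)"

definition clifford_scalar ::
  "'r::comm_ring_1^'m^'m \<Rightarrow> 'r \<Rightarrow> ('r, 'r^'m) free_algebra set set" where
  "clifford_scalar M r = quot_class tensor_algebra (clifford_relations M) (tensor_scalar r)"

definition symmetric_matrix :: "'r^'m^'m \<Rightarrow> bool" where
  "symmetric_matrix M \<longleftrightarrow> transpose M = M"

definition nondegenerate :: "'r::idom^'m^'m \<Rightarrow> bool" where
  "nondegenerate M \<longleftrightarrow> det M \<noteq> 0"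


section \<open>The polynomial ring in three variables\<close>

text \<open>Keys are the monomials, i.e. exponent vectors indexed by the three-element type \<open>3\<close>.\<close>

type_synonym poly3 = "(3 \<Rightarrow>\<^sub>0 nat) \<Rightarrow>\<^sub>0 complex"

end

theory Submission
  imports Defs
begin

text \<open>
  In \<open>\<Lambda>\<^sub>c\<close> the elements \<open>X\<^sup>2\<close>, \<open>Y\<^sup>2\<close> and \<open>(XY + YX)/2\<close> are central, so \<open>\<Lambda>\<^sub>c\<close> is an algebra
  over \<open>\<complex>[x, y, z]\<close>, and \<open>X, Y, Z\<close> satisfy the Clifford relations of the form with matrix
  \<open>((x, z, 0), (z, y, 0), (0, 0, 1))\<close>, whose determinant is \<open>xy - z\<^sup>2\<close>. Sending \<open>X, Y, Z\<close> to the
  basis vectors defines a map from the free algebra to the Clifford algebra. It is onto because half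
  the anticommutators of the basis vectors are the variables \<open>x, y, z\<close>. Its kernel is the conifold
  ideal because the Clifford algebra maps back to \<open>\<Lambda>\<^sub>c\<close> by its universal property.
\<close>

section \<open>Homomorphisms out of monoid algebras\<close>

text \<open>Zero counts as a monomial with coefficient 0, and an update at a key outside the support
  is the addition of a monomial.\<close>

lemma poly_mapping_add_induct [case_names single add]:
  assumes single: "\<And>k c. P (Poly_Mapping.single k c)"
    and add: "\<And>f g. P f \<Longrightarrow> P g \<Longrightarrow> P (f + g)"
  shows "P (f :: 'k \<Rightarrow>\<^sub>0 'r::monoid_add)"
proof (induction f rule: update_induct)
  case const
  show ?case using single[of undefined 0] by simp
next
  case (update f k v)
  have "Poly_Mapping.update k v f = f + Poly_Mapping.single k v"
    using update(1) by (auto intro!: poly_mapping_eqI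
        simp: lookup_update lookup_add lookup_single when_def in_keys_iff)
  then show ?case using add[OF update(3) single] by simp
qed

text \<open>One formula serves two evaluations: of free algebras, where the keys are words, and of
  polynomials, where the keys are exponent vectors.\<close>

definition eval_monoid_algebra :: "('r::zero \<Rightarrow> 'a::semiring_0) \<Rightarrow> ('m \<Rightarrow> 'a) \<Rightarrow> ('m \<Rightarrow>\<^sub>0 'r) \<Rightarrow> 'a" where
  "eval_monoid_algebra h g f = (\<Sum>k\<in>Poly_Mapping.keys f. h (Poly_Mapping.lookup f k) * g k)"

locale unital_ring_hom =
  fixes h :: "'r::ring_1 \<Rightarrow> 'a::ring_1"
  assumes hom_add: "h (a + b) = h a + h b"
    and hom_mult: "h (a * b) = h a * h b"
    and hom_one: "h 1 = 1"
begin

lemma hom_zero: "h 0 = 0"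
  using hom_add[of 0 0] by simp

lemma hom_uminus: "h (- a) = - h a"
  using hom_add[of a "- a"] by (simp add: hom_zero eq_neg_iff_add_eq_0 add.commute)

lemma hom_diff: "h (a - b) = h a - h b"
  using hom_add[of a "- b"] by (simp add: hom_uminus)

lemma hom_sum: "h (sum f A) = (\<Sum>i\<in>A. h (f i))"
  by (induction A rule: infinite_finite_induct) (simp_all add: hom_zero hom_add)

lemma hom_power: "h (a ^ n) = h a ^ n"
  by (induction n) (simp_all add: hom_one hom_mult)

lemmas hom_simps = hom_add hom_mult hom_one hom_zero hom_uminus hom_diff

end

text \<open>The universal property of a monoid algebra. Coefficients commute with monomials there,
  so their images have to commute as well.\<close>

locale monoid_algebra_eval = unital_ring_hom h
  for h :: "'r::ring_1 \<Rightarrow> 'a::ring_1" +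
  fixes g :: "'m::monoid_add \<Rightarrow> 'a"
  assumes g_zero: "g 0 = 1"
    and g_add: "g (k + l) = g k * g l"
    and commute: "h c * g k = g k * h c"
begin

abbreviation "ev \<equiv> eval_monoid_algebra h g"

lemma ev_single: "ev (Poly_Mapping.single k c) = h c * g k"
  by (simp add: eval_monoid_algebra_def hom_zero)

lemma ev_add: "ev (p + q) = ev p + ev q"
  unfolding eval_monoid_algebra_def
  by (rule setsum_keys_plus_distrib) (simp_all add: hom_zero hom_add distrib_right)

text \<open>Both sides are additive in each factor, which leaves monomials; there the second
  coefficient moves past \<open>g k\<close> by \<open>commute\<close>.\<close>

lemma ev_mult: "ev (p * q) = ev p * ev q"
proof (induction p rule: poly_mapping_add_induct)
  case (single k c)
  show ?case
  proof (induction q rule: poly_mapping_add_induct)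
    case (single l d)
    have "g k * (h d * g l) = h d * (g k * g l)"
      by (metis commute mult.assoc)
    then show ?case
      by (simp add: mult_single ev_single hom_mult g_add mult.assoc)
  qed (simp add: ev_add distrib_left)
qed (simp add: ev_add distrib_right)

lemma ev_one: "ev 1 = 1"
  using ev_single[of 0 1] by (simp add: hom_one g_zero)

lemma ev_hom: "unital_ring_hom ev"
  by unfold_locales (simp_all add: ev_add ev_mult ev_one)

lemma ev_alg_const: "ev (Poly_Mapping.single 0 c) = h c"
  by (simp add: ev_single g_zero)

end

lemma alg_const_hom: "unital_ring_hom (alg_const :: 'r::comm_ring_1 \<Rightarrow> ('m::monoid_add \<Rightarrow>\<^sub>0 'r))"
  by unfold_locales (simp_all add: alg_const_def single_add mult_single)

lemma alg_const_commute: "alg_const r * f = f * alg_const r"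
  by (induction f rule: poly_mapping_add_induct)
    (simp_all add: alg_const_def mult_single mult.commute distrib_left distrib_right)

section \<open>Words and evaluation on free algebras\<close>

definition word_eval :: "('x \<Rightarrow> 'a::monoid_mult) \<Rightarrow> 'x word \<Rightarrow> 'a" where
  "word_eval f w = prod_list (map f (letters w))"

lemma word_eval_zero: "word_eval f 0 = 1"
  by (simp add: word_eval_def zero_word_def)

lemma word_eval_add: "word_eval f (u + w) = word_eval f u * word_eval f w"
  by (simp add: word_eval_def plus_word_def)

lemma word_eval_Word: "word_eval f (Word [x]) = f x"
  by (simp add: word_eval_def)

lemma word_eval_commute:
  assumes "\<And>x. c * f x = f x * c"
  shows "c * word_eval f w = word_eval f w * c"
proof -
  have "c * prod_list (map f xs) = prod_list (map f xs) * c" for xs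
  proof (induction xs)
    case (Cons x xs)
    then show ?case by simp (metis assms mult.assoc)
  qed simp
  then show ?thesis by (simp add: word_eval_def)
qed

text \<open>Each monomial is a constant times a product of letters, and each element is a sum of
  monomials.\<close>

lemma free_algebra_induct [case_names const gen add mult]:
  assumes const: "\<And>r. P (alg_const r)"
    and gen: "\<And>x. P (gen x)"
    and add: "\<And>f g. P f \<Longrightarrow> P g \<Longrightarrow> P (f + g)"
    and mult: "\<And>f g. P f \<Longrightarrow> P g \<Longrightarrow> P (f * g)"
  shows "P (f :: ('r::comm_ring_1, 'x) free_algebra)"
proof (induction f rule: poly_mapping_add_induct)
  case (single w c)
  have "P (Poly_Mapping.single (Word xs) 1)" for xs
  proof (induction xs)
    case Nil
    then show ?case using const[of 1] by (simp add: alg_const_def zero_word_def)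
  next
    case (Cons x xs)
    have "Poly_Mapping.single (Word (x # xs)) 1 = (gen x * Poly_Mapping.single (Word xs) 1 :: ('r, 'x) free_algebra)"
      by (simp add: gen_def mult_single plus_word_def)
    then show ?case using mult[OF gen Cons] by simp
  qed
  from mult[OF const[of c] this[of "letters w"]]
  show ?case by (simp add: alg_const_def mult_single)
qed (rule add)

locale free_algebra_eval = unital_ring_hom h
  for h :: "'r::comm_ring_1 \<Rightarrow> 'a::ring_1" +
  fixes f :: "'x \<Rightarrow> 'a"
  assumes gen_commute: "h c * f x = f x * h c"
begin

sublocale monoid_algebra_eval h "word_eval f"
  by unfold_locales (simp_all add: word_eval_zero word_eval_add word_eval_commute gen_commute)

abbreviation "fev \<equiv> eval_monoid_algebra h (word_eval f)"

sublocale fev: unital_ring_hom fev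
  by (rule ev_hom)

lemma fev_const: "fev (alg_const c) = h c"
  by (simp add: alg_const_def ev_alg_const)

lemma fev_gen: "fev (gen x) = f x"
  by (simp add: gen_def ev_single word_eval_Word hom_one)

end

section \<open>Quotients by generated ideals\<close>

lemma ring_ring_of_type_algebra: "ring (ring_of_type_algebra :: 'a::ring_1 ring)"
proof -
  have "\<exists>y. x + y = 0" "\<exists>y. y + x = 0" for x :: 'a
    by (rule exI[of _ "- x"], simp)+
  then show ?thesis
    unfolding ring_of_type_algebra_def
    by unfold_locales (auto simp: algebra_simps Units_def)
qed

lemma ring_of_type_algebra_simps [simp]:
  "carrier (ring_of_type_algebra :: 'a::ring_1 ring) = UNIV"
  "x \<otimes>\<^bsub>ring_of_type_algebra\<^esub> y = (x * y :: 'a)"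
  "x \<oplus>\<^bsub>ring_of_type_algebra\<^esub> y = (x + y :: 'a)"
  "\<zero>\<^bsub>ring_of_type_algebra\<^esub> = (0 :: 'a)"
  "\<one>\<^bsub>ring_of_type_algebra\<^esub> = (1 :: 'a)"
  by (simp_all add: ring_of_type_algebra_def)

lemma a_inv_ring_of_type_algebra [simp]:
  "\<ominus>\<^bsub>ring_of_type_algebra\<^esub> x = (- x :: 'a::ring_1)"
proof -
  interpret ring "ring_of_type_algebra :: 'a ring" by (rule ring_ring_of_type_algebra)
  show ?thesis using minus_equality[of "- x" x] by simp
qed

text \<open>Negatives come from multiplication by \<open>- 1\<close>, so the listed closure
  properties already give an additive subgroup.\<close>

lemma ideal_ring_of_type_algebra_iff:
  "ideal I (ring_of_type_algebra :: 'a::ring_1 ring) \<longleftrightarrow>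
    0 \<in> I \<and> (\<forall>a\<in>I. \<forall>b\<in>I. a + b \<in> I) \<and> (\<forall>a\<in>I. \<forall>x. x * a \<in> I \<and> a * x \<in> I)"
proof
  assume "ideal I (ring_of_type_algebra :: 'a ring)"
  then interpret ideal I "ring_of_type_algebra :: 'a ring" .
  show "0 \<in> I \<and> (\<forall>a\<in>I. \<forall>b\<in>I. a + b \<in> I) \<and> (\<forall>a\<in>I. \<forall>x. x * a \<in> I \<and> a * x \<in> I)"
    using additive_subgroup.zero_closed[OF additive_subgroup_axioms]
      additive_subgroup.a_closed[OF additive_subgroup_axioms] I_l_closed I_r_closed by simp
next
  assume I: "0 \<in> I \<and> (\<forall>a\<in>I. \<forall>b\<in>I. a + b \<in> I) \<and> (\<forall>a\<in>I. \<forall>x. x * a \<in> I \<and> a * x \<in> I)"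
  then have minus: "- a \<in> I" if "a \<in> I" for a
    using that by (metis mult_minus1)
  interpret ring "ring_of_type_algebra :: 'a ring" by (rule ring_ring_of_type_algebra)
  show "ideal I (ring_of_type_algebra :: 'a ring)"
  proof (rule idealI)
    show "subgroup I (add_monoid ring_of_type_algebra)"
      using I minus by (intro add.subgroupI) (auto simp flip: a_inv_def)
  qed (use I ring_axioms in auto)
qed

text \<open>Serves to bound generated ideals from above: a homomorphism that kills the generators
  kills the ideal.\<close>

lemma kernel_ideal:
  assumes "unital_ring_hom (h :: 'a::ring_1 \<Rightarrow> 'b::ring_1)"
  shows "ideal {a. h a = 0} ring_of_type_algebra"
proof -
  interpret unital_ring_hom h by fact
  show ?thesis
    by (simp add: ideal_ring_of_type_algebra_iff hom_simps)
qed

context ring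
begin

context
  fixes S assumes S: "S \<subseteq> carrier R"
begin

lemma quot_ring_ring: "ring (quot_ring R S)"
  using ideal.quotient_is_ring[OF genideal_ideal[OF S]] by (simp add: quot_ring_def)

lemma quot_class_ring_hom: "quot_class R S \<in> ring_hom R (quot_ring R S)"
  using ideal.rcos_ring_hom[OF genideal_ideal[OF S]]
  unfolding quot_class_def[abs_def] quot_ring_def .

lemma quot_class_image: "quot_class R S ` carrier R = carrier (quot_ring R S)"
  by (auto simp: quot_ring_def quot_class_def FactRing_simps)

lemma quot_class_eq_zero_iff:
  assumes "a \<in> carrier R"
  shows "quot_class R S a = \<zero>\<^bsub>quot_ring R S\<^esub> \<longleftrightarrow> a \<in> Idl S"
proof -
  interpret I: ideal "Idl S" R by (rule genideal_ideal[OF S])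
  show ?thesis
    using I.rcos_const_imp_mem[OF assms] I.a_rcos_const
    by (auto simp: quot_class_def quot_ring_def FactRing_simps)
qed

lemma quot_class_eq_iff:
  assumes "a \<in> carrier R" "b \<in> carrier R"
  shows "quot_class R S a = quot_class R S b \<longleftrightarrow> a \<ominus> b \<in> Idl S"
  using quotient_eq_iff_same_a_r_cos[OF genideal_ideal[OF S] assms(1,2)]
  by (simp add: quot_class_def)

lemma quot_class_ideal:
  assumes "ideal J R"
  shows "ideal (quot_class R S ` J) (quot_ring R S)"
  using ring_ideal_imp_quot_ideal[OF genideal_ideal[OF S] assms]
  unfolding quot_class_def[abs_def] quot_ring_def .

end

end

section \<open>Clifford algebras\<close>

interpretation type_ring: ring "ring_of_type_algebra :: 'a::ring_1 ring"
  by (rule ring_ring_of_type_algebra)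

interpretation tensor: ring "tensor_algebra :: ('r::comm_ring_1, 'r^'m) free_algebra set ring"
  unfolding tensor_algebra_def by (rule type_ring.quot_ring_ring) simp

lemma tensor_class_hom:
  "ring_hom_ring ring_of_type_algebra (tensor_algebra :: ('r::comm_ring_1, 'r^'m) free_algebra set ring)
    (quot_class ring_of_type_algebra tensor_relations)"
  unfolding tensor_algebra_def
  by (intro ring_hom_ringI2 ring_ring_of_type_algebra type_ring.quot_ring_ring
      type_ring.quot_class_ring_hom) simp_all

text \<open>The Clifford relations live in the tensor algebra, itself a quotient; these are their
  lifts to the free algebra on vectors.\<close>

definition clifford_relator ::
  "'r::comm_ring_1^'m^'m \<Rightarrow> 'r^'m \<Rightarrow> 'r^'m \<Rightarrow> ('r, 'r^'m) free_algebra" where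
  "clifford_relator M v w = gen v * gen w + gen w * gen v - alg_const (2 * bilin_form M v w)"

lemma clifford_relations_eq:
  "clifford_relations M =
    {quot_class ring_of_type_algebra tensor_relations (clifford_relator M v w) | v w. True}"
proof -
  interpret q: ring_hom_ring ring_of_type_algebra tensor_algebra
      "quot_class ring_of_type_algebra tensor_relations :: ('a, 'a^'b) free_algebra \<Rightarrow> _"
    by (rule tensor_class_hom)
  have "quot_class ring_of_type_algebra tensor_relations (clifford_relator M v w) =
      (tensor_vec v \<otimes>\<^bsub>tensor_algebra\<^esub> tensor_vec w
        \<oplus>\<^bsub>tensor_algebra\<^esub> tensor_vec w \<otimes>\<^bsub>tensor_algebra\<^esub> tensor_vec v)
      \<ominus>\<^bsub>tensor_algebra\<^esub> tensor_scalar (2 * bilin_form M v w)" for v w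
    unfolding clifford_relator_def tensor_vec_def tensor_scalar_def a_minus_def
    using q.hom_mult[of "gen v" "gen w"] q.hom_mult[of "gen w" "gen v"]
      q.hom_add[of "gen v * gen w" "gen w * gen v"]
      q.hom_add[of "gen v * gen w + gen w * gen v" "- alg_const (2 * bilin_form M v w)"]
      q.hom_a_inv[of "alg_const (2 * bilin_form M v w)"]
    by simp
  then show ?thesis
    by (simp add: clifford_relations_def)
qed

lemma clifford_relations_carrier: "clifford_relations M \<subseteq> carrier tensor_algebra"
  using ring_hom_closed[OF ring_hom_ring.homh[OF tensor_class_hom]]
  by (auto simp: clifford_relations_eq)

definition clifford_class ::
  "'r::comm_ring_1^'m^'m \<Rightarrow> ('r, 'r^'m) free_algebra \<Rightarrow> ('r, 'r^'m) free_algebra set set" where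
  "clifford_class M b =
    quot_class tensor_algebra (clifford_relations M) (quot_class ring_of_type_algebra tensor_relations b)"

lemma clifford_class_alg_const: "clifford_class M (alg_const r) = clifford_scalar M r"
  by (simp add: clifford_class_def clifford_scalar_def tensor_scalar_def)

lemma ring_clifford_algebra: "ring (clifford_algebra M)"
  unfolding clifford_algebra_def
  by (rule tensor.quot_ring_ring[OF clifford_relations_carrier])

lemma clifford_class_hom: "ring_hom_ring ring_of_type_algebra (clifford_algebra M) (clifford_class M)"
proof -
  have "quot_class tensor_algebra (clifford_relations M) \<in> ring_hom tensor_algebra (clifford_algebra M)"
    unfolding clifford_algebra_def
    by (rule tensor.quot_class_ring_hom[OF clifford_relations_carrier])
  from ring_hom_trans[OF ring_hom_ring.homh[OF tensor_class_hom] this]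
  have "clifford_class M \<in> ring_hom ring_of_type_algebra (clifford_algebra M)"
    by (simp add: clifford_class_def[abs_def] comp_def)
  then show ?thesis
    by (intro ring_hom_ringI2 ring_ring_of_type_algebra ring_clifford_algebra)
qed

lemma range_clifford_class: "range (clifford_class M) = carrier (clifford_algebra M)"
proof -
  have "range (quot_class ring_of_type_algebra tensor_relations :: ('a, 'a^'b) free_algebra \<Rightarrow> _)
      = carrier tensor_algebra"
    using type_ring.quot_class_image[of tensor_relations] by (simp add: tensor_algebra_def)
  then show ?thesis
    using tensor.quot_class_image[OF clifford_relations_carrier, of M]
    by (simp add: clifford_class_def[abs_def] clifford_algebra_def image_image[symmetric])
qed

lemma clifford_class_tensor_relation:
  assumes "t \<in> tensor_relations"
  shows "clifford_class M t = \<zero>\<^bsub>clifford_algebra M\<^esub>"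
proof -
  interpret p: ring_hom_ring tensor_algebra "clifford_algebra M"
      "quot_class tensor_algebra (clifford_relations M)"
    unfolding clifford_algebra_def
    by (intro ring_hom_ringI2 tensor.ring_axioms tensor.quot_ring_ring
        tensor.quot_class_ring_hom clifford_relations_carrier)
  have "quot_class ring_of_type_algebra tensor_relations t = \<zero>\<^bsub>tensor_algebra\<^esub>"
    using type_ring.quot_class_eq_zero_iff[of tensor_relations t]
      type_ring.genideal_self[of tensor_relations] assms
    by (auto simp: tensor_algebra_def)
  then show ?thesis
    by (simp add: clifford_class_def)
qed

lemma clifford_class_relator: "clifford_class M (clifford_relator M v w) = \<zero>\<^bsub>clifford_algebra M\<^esub>"
proof -
  have "quot_class ring_of_type_algebra tensor_relations (clifford_relator M v w) \<in> clifford_relations M"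
    by (auto simp: clifford_relations_eq)
  then show ?thesis
    using tensor.quot_class_eq_zero_iff[OF clifford_relations_carrier]
      tensor.genideal_self[OF clifford_relations_carrier] clifford_relations_carrier[of M]
    unfolding clifford_class_def clifford_algebra_def by blast
qed

text \<open>The image of \<open>J\<close> in the tensor algebra is an ideal containing the Clifford
  relations. Hence \<open>b\<close> agrees with an element of \<open>J\<close> up to the ideal of
  the tensor relations, which lies in \<open>J\<close>. This treats the two successive quotients as
  a single one.\<close>

lemma clifford_class_eq_zero_imp_mem:
  assumes J: "ideal J ring_of_type_algebra" "tensor_relations \<subseteq> J" "\<And>v w. clifford_relator M v w \<in> J"
    and b: "clifford_class M b = \<zero>\<^bsub>clifford_algebra M\<^esub>"
  shows "b \<in> J"
proof -
  let ?q = "quot_class ring_of_type_algebra tensor_relations"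
  interpret q: ring_hom_ring ring_of_type_algebra tensor_algebra "?q :: ('a, 'a^'b) free_algebra \<Rightarrow> _"
    by (rule tensor_class_hom)
  have qJ: "ideal (?q ` J) tensor_algebra"
    unfolding tensor_algebra_def by (rule type_ring.quot_class_ideal[OF _ J(1)]) simp
  have "?q b \<in> Idl\<^bsub>tensor_algebra\<^esub> clifford_relations M"
    using b tensor.quot_class_eq_zero_iff[OF clifford_relations_carrier, of "?q b"] q.hom_closed[of b]
    by (simp add: clifford_class_def clifford_algebra_def)
  also have "\<dots> \<subseteq> ?q ` J"
    by (rule tensor.genideal_minimal[OF qJ]) (use J(3) in \<open>auto simp: clifford_relations_eq\<close>)
  finally obtain b' where b': "b' \<in> J" "?q b = ?q b'" by auto
  have "b - b' \<in> Idl\<^bsub>ring_of_type_algebra\<^esub> tensor_relations"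
    using b'(2) type_ring.quot_class_eq_iff[of tensor_relations b b'] by (simp add: a_minus_def)
  also have "\<dots> \<subseteq> J"
    by (rule type_ring.genideal_minimal[OF J(1,2)])
  finally have "b - b' + b' \<in> J"
    using J(1) b'(1) unfolding ideal_ring_of_type_algebra_iff by blast
  then show ?thesis by simp
qed

section \<open>The universal property of the Clifford algebra, with relations checked on a
  basis\<close>

locale clifford_eval = unital_ring_hom h
  for h :: "'r::comm_ring_1 \<Rightarrow> 'a::ring_1" +
  fixes M :: "'r^'m^'m" and E :: "'m \<Rightarrow> 'a"
  assumes E_commute: "h c * E i = E i * h c"
    and E_relation: "E i * E j + E j * E i = h (2 * M $ i $ j)"
begin

definition lin :: "'r^'m \<Rightarrow> 'a" where
  "lin v = (\<Sum>i\<in>UNIV. h (v $ i) * E i)"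

lemma h_commute: "h c * h d = h d * h c"
  by (simp add: mult.commute flip: hom_mult)

sublocale free_algebra_eval h lin
proof
  have "h c * (h d * E i) = h d * E i * h c" for c d i
    by (metis E_commute h_commute mult.assoc)
  then show "h c * lin v = lin v * h c" for c v
    by (simp add: lin_def sum_distrib_left sum_distrib_right)
qed

lemma lin_add: "lin (v + w) = lin v + lin w"
  by (simp add: lin_def hom_add distrib_right sum.distrib)

lemma lin_smult: "lin (r *s v) = h r * lin v"
  by (simp add: lin_def hom_mult sum_distrib_left mult.assoc)

lemma lin_axis: "lin (axis i 1) = E i"
proof -
  have "lin (axis i 1) = (\<Sum>j\<in>UNIV. if j = i then E j else 0)"
    unfolding lin_def by (rule sum.cong) (simp_all add: axis_def hom_one hom_zero)
  then show ?thesis by simp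
qed

text \<open>Both sides are bilinear in \<open>v\<close> and \<open>w\<close>, so the relation
  between basis images, weighted by coordinates and summed, gives it for all vectors.\<close>

lemma lin_relation: "lin v * lin w + lin w * lin v = h (2 * bilin_form M v w)"
proof -
  have *: "(h a * E i) * (h b * E j) = h a * h b * (E i * E j)" for a b i j
    by (metis E_commute mult.assoc)
  have vw: "lin v * lin w = (\<Sum>i\<in>UNIV. \<Sum>j\<in>UNIV. h (v $ i) * h (w $ j) * (E i * E j))"
    unfolding lin_def sum_product * ..
  have "lin w * lin v = (\<Sum>i\<in>UNIV. \<Sum>j\<in>UNIV. h (w $ i) * h (v $ j) * (E i * E j))"
    unfolding lin_def sum_product * ..
  \<comment> \<open>Renaming the indices and exchanging the scalar factors gives the second product
    the same coefficients as the first.\<close>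
  also have "\<dots> = (\<Sum>i\<in>UNIV. \<Sum>j\<in>UNIV. h (v $ i) * h (w $ j) * (E j * E i))"
    by (subst sum.swap) (simp add: h_commute[of "w $ _"])
  finally have "lin v * lin w + lin w * lin v =
      (\<Sum>i\<in>UNIV. \<Sum>j\<in>UNIV. h (v $ i) * h (w $ j) * (E i * E j + E j * E i))"
    by (simp add: vw sum.distrib distrib_left)
  also have "\<dots> = h (\<Sum>i\<in>UNIV. \<Sum>j\<in>UNIV. v $ i * w $ j * (2 * M $ i $ j))"
    by (simp add: E_relation hom_sum flip: hom_mult)
  also have "(\<Sum>i\<in>UNIV. \<Sum>j\<in>UNIV. v $ i * w $ j * (2 * M $ i $ j)) = 2 * bilin_form M v w"
    by (simp add: bilin_form_def matrix_vector_mult_def sum_distrib_left mult_ac)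
  finally show ?thesis .
qed

text \<open>This is the factorization of \<open>fev\<close> through the Clifford algebra: its kernel
  is an ideal that contains the tensor relations and all \<open>clifford_relator\<close>
  elements.\<close>

lemma fev_eq_zero:
  assumes "clifford_class M b = \<zero>\<^bsub>clifford_algebra M\<^esub>"
  shows "fev b = 0"
proof -
  have "b \<in> {b. fev b = 0}"
  proof (rule clifford_class_eq_zero_imp_mem[OF _ _ _ assms])
    show "ideal {b. fev b = 0} ring_of_type_algebra"
      by (rule kernel_ideal[OF ev_hom])
    show "tensor_relations \<subseteq> {b. fev b = 0}"
      by (auto simp: tensor_relations_def fev.hom_simps fev_gen fev_const lin_add lin_smult)
    show "clifford_relator M v w \<in> {b. fev b = 0}" for v w
      by (simp add: clifford_relator_def fev.hom_simps fev_gen fev_const lin_relation)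
  qed
  then show ?thesis by simp
qed

end

section \<open>Calculation with classes in the Clifford algebra\<close>

lemma bilin_form_axis: "bilin_form M (axis i 1) (axis j 1) = M $ i $ j"
proof -
  have "(M *v axis j 1) $ i = (\<Sum>k\<in>UNIV. if k = j then M $ i $ k else 0)" for i
    unfolding matrix_vector_mult_def vec_lambda_beta by (rule sum.cong) (simp_all add: axis_def)
  then have "bilin_form M (axis i 1) (axis j 1) = (\<Sum>k\<in>UNIV. if k = i then M $ k $ j else 0)"
    unfolding bilin_form_def by (intro sum.cong) (simp_all add: axis_def)
  then show ?thesis by simp
qed

context
  fixes M :: "'r::comm_ring_1^'m^'m"
begin

interpretation c: ring_hom_ring ring_of_type_algebra "clifford_algebra M" "clifford_class M"
  by (rule clifford_class_hom)

lemma clifford_class_add: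
  "clifford_class M (a + b) = clifford_class M a \<oplus>\<^bsub>clifford_algebra M\<^esub> clifford_class M b"
  using c.hom_add[of a b] by simp

lemma clifford_class_mult:
  "clifford_class M (a * b) = clifford_class M a \<otimes>\<^bsub>clifford_algebra M\<^esub> clifford_class M b"
  using c.hom_mult[of a b] by simp

lemma clifford_class_eq_iff:
  "clifford_class M a = clifford_class M b \<longleftrightarrow> clifford_class M (a - b) = \<zero>\<^bsub>clifford_algebra M\<^esub>"
proof -
  have "clifford_class M (a - b) = clifford_class M a \<ominus>\<^bsub>clifford_algebra M\<^esub> clifford_class M b"
    using c.hom_add[of a "- b"] c.hom_a_inv[of b] by (simp add: a_minus_def)
  then show ?thesis
    using c.S.r_right_minus_eq[OF c.hom_closed[of a] c.hom_closed[of b]] by simp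
qed

lemma clifford_class_gen_add: "clifford_class M (gen (v + w)) = clifford_class M (gen v + gen w)"
proof -
  have "gen (v + w) - gen v - gen w \<in> (tensor_relations :: ('r, 'r^'m) free_algebra set)"
    unfolding tensor_relations_def by blast
  then show ?thesis
    using clifford_class_tensor_relation[of _ M] by (simp add: clifford_class_eq_iff diff_diff_eq)
qed

lemma clifford_class_gen_smult: "clifford_class M (gen (r *s v)) = clifford_class M (alg_const r * gen v)"
proof -
  have "gen (r *s v) - alg_const r * gen v \<in> (tensor_relations :: ('r, 'r^'m) free_algebra set)"
    unfolding tensor_relations_def by blast
  then show ?thesis
    using clifford_class_tensor_relation[of _ M] by (simp add: clifford_class_eq_iff)
qed

lemma clifford_class_anticommutator:
  "clifford_class M (gen v * gen w + gen w * gen v) = clifford_class M (alg_const (2 * bilin_form M v w))"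
  using clifford_class_relator[of M v w] by (simp add: clifford_class_eq_iff clifford_relator_def)

text \<open>The defining relation yields only twice the form; \<open>k\<close> is one half and
  removes the factor. Values of the form thereby become expressions in the vectors, which is what
  surjectivity rests on.\<close>

lemma clifford_class_half_anticommutator:
  assumes "k + k = 1"
  shows "clifford_class M (alg_const (bilin_form M v w)) =
    clifford_class M (alg_const k * (gen v * gen w + gen w * gen v))"
proof -
  interpret ac: unital_ring_hom "alg_const :: 'r \<Rightarrow> ('r, 'r^'m) free_algebra" by (rule alg_const_hom)
  have "k * (2 * bilin_form M v w) = (k + k) * bilin_form M v w"
    by (simp add: algebra_simps)
  then have "alg_const (bilin_form M v w) =
      (alg_const k * alg_const (2 * bilin_form M v w) :: ('r, 'r^'m) free_algebra)"
    using assms by (simp flip: ac.hom_mult)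
  then show ?thesis
    by (simp add: clifford_class_mult clifford_class_anticommutator)
qed

lemma clifford_class_square:
  assumes "k + k = (1::'r)"
  shows "clifford_class M (gen v * gen v) = clifford_class M (alg_const (bilin_form M v v))"
proof -
  interpret ac: unital_ring_hom "alg_const :: 'r \<Rightarrow> ('r, 'r^'m) free_algebra" by (rule alg_const_hom)
  have "alg_const k * (gen v * gen v + gen v * gen v) =
      (alg_const (k + k) * (gen v * gen v) :: ('r, 'r^'m) free_algebra)"
    by (simp only: ac.hom_add distrib_left distrib_right)
  then have "alg_const k * (gen v * gen v + gen v * gen v) = (gen v * gen v :: ('r, 'r^'m) free_algebra)"
    by (simp add: assms ac.hom_one)
  then show ?thesis
    using clifford_class_half_anticommutator[OF assms, of v v] by simp
qed

end

section \<open>The conifold algebra as a ring type\<close>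

definition conifold_ideal :: "(complex, conifold_gen) free_algebra set" where
  "conifold_ideal = Idl\<^bsub>ring_of_type_algebra\<^esub> conifold_relations"

lemma ideal_conifold_ideal: "ideal conifold_ideal ring_of_type_algebra"
  unfolding conifold_ideal_def by (rule type_ring.genideal_ideal) simp

lemma conifold_ideal_closed:
  "0 \<in> conifold_ideal"
  "a \<in> conifold_ideal \<Longrightarrow> b \<in> conifold_ideal \<Longrightarrow> a + b \<in> conifold_ideal"
  "a \<in> conifold_ideal \<Longrightarrow> x * a \<in> conifold_ideal"
  "a \<in> conifold_ideal \<Longrightarrow> a * x \<in> conifold_ideal"
  using ideal_conifold_ideal unfolding ideal_ring_of_type_algebra_iff by auto

lemma conifold_ideal_uminus: "a \<in> conifold_ideal \<Longrightarrow> - a \<in> conifold_ideal"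
  using conifold_ideal_closed(3)[of a "- 1"] by simp

lemma conifold_relations_subset: "conifold_relations \<subseteq> conifold_ideal"
  unfolding conifold_ideal_def by (rule type_ring.genideal_self) simp

text \<open>The character \<open>X, Y \<mapsto> 0\<close>, \<open>Z \<mapsto> 1\<close> shows that the quotient is not the zero ring.\<close>

lemma one_notin_conifold_ideal: "1 \<notin> conifold_ideal"
proof -
  interpret ch: free_algebra_eval "\<lambda>c::complex. c" "\<lambda>g. if g = GZ then 1 else 0"
    by unfold_locales simp_all
  have "conifold_ideal \<subseteq> {a. ch.fev a = 0}"
    unfolding conifold_ideal_def
    by (rule type_ring.genideal_minimal[OF kernel_ideal[OF ch.ev_hom]])
      (auto simp: conifold_relations_def Let_def commutator_def ch.fev.hom_simps ch.fev.hom_power ch.fev_gen)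
  then show ?thesis
    by (auto simp: ch.fev.hom_one)
qed

\<comment> \<open>Evaluation maps take values in types of class \<open>ring_1\<close>, whereas
  \<open>conifold_algebra\<close> is a ring with a carrier set; this is the same quotient as a
  type.\<close>
quotient_type conifold = "(complex, conifold_gen) free_algebra" / "\<lambda>a b. a - b \<in> conifold_ideal"
  morphisms rep_conifold conifold_class
proof (rule equivpI)
  show "reflp (\<lambda>a b. a - b \<in> conifold_ideal)"
    by (rule reflpI) (simp add: conifold_ideal_closed)
  show "symp (\<lambda>a b. a - b \<in> conifold_ideal)"
    using conifold_ideal_uminus by (intro sympI) force
  show "transp (\<lambda>a b. a - b \<in> conifold_ideal)"
  proof (rule transpI)
    fix a b c assume "a - b \<in> conifold_ideal" "b - c \<in> conifold_ideal"
    from conifold_ideal_closed(2)[OF this] show "a - c \<in> conifold_ideal" by simp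
  qed
qed

instantiation conifold :: ring_1
begin

lift_definition zero_conifold :: conifold is 0 .
lift_definition one_conifold :: conifold is 1 .

lift_definition plus_conifold :: "conifold \<Rightarrow> conifold \<Rightarrow> conifold" is "(+)"
proof -
  fix a b c d assume "a - b \<in> conifold_ideal" "c - d \<in> conifold_ideal"
  from conifold_ideal_closed(2)[OF this] show "a + c - (b + d) \<in> conifold_ideal"
    by (simp add: algebra_simps)
qed

lift_definition uminus_conifold :: "conifold \<Rightarrow> conifold" is uminus
  using conifold_ideal_uminus by fastforce

lift_definition minus_conifold :: "conifold \<Rightarrow> conifold \<Rightarrow> conifold" is "(-)"
proof -
  fix a b c d assume "a - b \<in> conifold_ideal" "c - d \<in> conifold_ideal"
  from conifold_ideal_closed(2)[OF this(1) conifold_ideal_uminus[OF this(2)]]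
  show "a - c - (b - d) \<in> conifold_ideal"
    by (simp add: algebra_simps)
qed

lift_definition times_conifold :: "conifold \<Rightarrow> conifold \<Rightarrow> conifold" is "(*)"
proof -
  fix a b c d assume ab: "a - b \<in> conifold_ideal" and cd: "c - d \<in> conifold_ideal"
  from conifold_ideal_closed(2)[OF conifold_ideal_closed(4)[OF ab, of c] conifold_ideal_closed(3)[OF cd, of b]]
  show "a * c - b * d \<in> conifold_ideal"
    by (simp add: algebra_simps)
qed

instance
proof
  \<comment> \<open>Equality of 0 and 1 in the quotient means that \<open>0 - 1\<close> lies in the
    ideal, so the sign has to be removed first.\<close>
  have "1 \<in> conifold_ideal" if "- 1 \<in> conifold_ideal"
    using conifold_ideal_uminus[OF that] by simp
  then show "(0 :: conifold) \<noteq> 1"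
    using one_notin_conifold_ideal by transfer auto
qed (transfer; simp add: algebra_simps conifold_ideal_closed(1))+

end

lemma conifold_class_hom: "unital_ring_hom conifold_class"
  by unfold_locales
    (simp_all add: plus_conifold.abs_eq times_conifold.abs_eq one_conifold.abs_eq)

lemma conifold_class_eq_zero_iff: "conifold_class a = 0 \<longleftrightarrow> a \<in> conifold_ideal"
  unfolding zero_conifold.abs_eq conifold.abs_eq_iff by simp

section \<open>The conifold algebra as a Clifford algebra\<close>

definition pvar :: "3 \<Rightarrow> poly3" where
  "pvar i = Poly_Mapping.single (Poly_Mapping.single i 1) 1"

lemma single_eq_pvar_prod:
  "(Poly_Mapping.single m k :: poly3) =
    alg_const k * (pvar 1 ^ Poly_Mapping.lookup m 1 * pvar 2 ^ Poly_Mapping.lookup m 2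
      * pvar 3 ^ Poly_Mapping.lookup m 3)"
proof -
  have pow: "pvar i ^ n = Poly_Mapping.single (Poly_Mapping.single i n) 1" for i n
    by (induction n) (simp_all add: pvar_def mult_single flip: single_add)
  have "Poly_Mapping.lookup (Poly_Mapping.single 1 (Poly_Mapping.lookup m 1) +
      Poly_Mapping.single 2 (Poly_Mapping.lookup m 2) +
      Poly_Mapping.single 3 (Poly_Mapping.lookup m 3)) i = Poly_Mapping.lookup m i" for i :: 3
    using exhaust_3[of i] by (auto simp: lookup_add lookup_single)
  then have "Poly_Mapping.single 1 (Poly_Mapping.lookup m 1) +
      Poly_Mapping.single 2 (Poly_Mapping.lookup m 2) +
      Poly_Mapping.single 3 (Poly_Mapping.lookup m 3) = m"
    by (rule poly_mapping_eqI)
  then show ?thesis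
    by (simp add: pow alg_const_def mult_single)
qed

text \<open>The entries record \<open>X\<^sup>2\<close>, \<open>Y\<^sup>2\<close>, \<open>Z\<^sup>2 = 1\<close> and \<open>(XY + YX)/2\<close>.\<close>

definition conifold_matrix :: "poly3^3^3" where
  "conifold_matrix = (\<chi> i j. if i = 3 \<or> j = 3 then if i = j then 1 else 0
    else if i = j then pvar i else pvar 3)"

lemma conifold_matrix_nth [simp]:
  "conifold_matrix $ 1 $ 1 = pvar 1" "conifold_matrix $ 1 $ 2 = pvar 3" "conifold_matrix $ 1 $ 3 = 0"
  "conifold_matrix $ 2 $ 1 = pvar 3" "conifold_matrix $ 2 $ 2 = pvar 2" "conifold_matrix $ 2 $ 3 = 0"
  "conifold_matrix $ 3 $ 1 = 0" "conifold_matrix $ 3 $ 2 = 0" "conifold_matrix $ 3 $ 3 = 1"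
  by (simp_all add: conifold_matrix_def)

lemma symmetric_conifold_matrix: "symmetric_matrix conifold_matrix"
  by (auto simp: symmetric_matrix_def conifold_matrix_def transpose_def vec_eq_iff)

text \<open>The determinant has coefficient 1 at the monomial of \<open>pvar 1 * pvar 2\<close>,
  because the square of \<open>pvar 3\<close> is a different monomial.\<close>

lemma nondegenerate_conifold_matrix: "nondegenerate conifold_matrix"
proof -
  \<comment> \<open>The two monomials are told apart by their exponent at the first variable, 0
    against 1.\<close>
  have "Poly_Mapping.lookup (Poly_Mapping.single (3::3) 1 + Poly_Mapping.single 3 1) 1
      \<noteq> (Poly_Mapping.lookup (Poly_Mapping.single 1 1 + Poly_Mapping.single 2 1) 1 :: nat)"
    by (simp add: lookup_add lookup_single)
  then have neq: "Poly_Mapping.single (3::3) (1::nat) + Poly_Mapping.single 3 1 \<noteq>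
      Poly_Mapping.single 1 1 + Poly_Mapping.single 2 1"
    by metis
  have "det conifold_matrix = pvar 1 * pvar 2 - pvar 3 * pvar 3"
    by (simp add: det_3)
  moreover have "Poly_Mapping.lookup (pvar 1 * pvar 2 - pvar 3 * pvar 3)
      (Poly_Mapping.single 1 1 + Poly_Mapping.single 2 1) = 1"
    using neq by (simp add: pvar_def mult_single lookup_minus lookup_single)
  ultimately show ?thesis
    by (auto simp: nondegenerate_def)
qed

fun gen_index :: "conifold_gen \<Rightarrow> 3" where
  "gen_index GX = 1" | "gen_index GY = 2" | "gen_index GZ = 3"

section \<open>Central elements and Clifford relations obtained from the conifold relations in an
  arbitrary ring\<close>

locale conifold_elements = unital_ring_hom \<kappa>
  for \<kappa> :: "complex \<Rightarrow> 'a::ring_1" +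
  fixes x y z :: 'a
  assumes kx: "\<kappa> c * x = x * \<kappa> c" and ky: "\<kappa> c * y = y * \<kappa> c" and kz: "\<kappa> c * z = z * \<kappa> c"
    and zz: "z * z = 1" and xz: "x * z = - (z * x)" and yz: "y * z = - (z * y)"
    and xxy: "x * x * y = y * (x * x)" and yyx: "y * y * x = x * (y * y)"
begin

text \<open>The value for the third polynomial variable, forced by the off-diagonal Clifford
  relation between \<open>x\<close> and \<open>y\<close>.\<close>

definition w :: 'a where
  "w = \<kappa> (1/2) * (x * y + y * x)"

lemma half_add: "\<kappa> (1/2) * a + \<kappa> (1/2) * a = a"
  by (simp add: hom_one flip: distrib_right hom_add)

lemma w_add: "w + w = x * y + y * x"
  by (simp add: w_def half_add)

text \<open>Moving \<open>x * x\<close> past \<open>z\<close> changes the sign twice; moving it past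
  \<open>y\<close> is one of the conifold relations.\<close>

lemma xx_commute:
  "x * x * x = x * (x * x)" "x * x * y = y * (x * x)" "x * x * z = z * (x * x)" "\<kappa> c * (x * x) = x * x * \<kappa> c"
proof -
  show "x * x * z = z * (x * x)"
    by (metis xz mult.assoc minus_mult_left minus_mult_right minus_minus)
  show "\<kappa> c * (x * x) = x * x * \<kappa> c"
    by (metis kx mult.assoc)
qed (rule mult.assoc xxy)+

lemma yy_commute:
  "y * y * x = x * (y * y)" "y * y * y = y * (y * y)" "y * y * z = z * (y * y)" "\<kappa> c * (y * y) = y * y * \<kappa> c"
proof -
  show "y * y * z = z * (y * y)"
    by (metis yz mult.assoc minus_mult_left minus_mult_right minus_minus)
  show "\<kappa> c * (y * y) = y * y * \<kappa> c"
    by (metis ky mult.assoc)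
qed (rule mult.assoc yyx)+

lemma w_commute_if:
  assumes "(x * y + y * x) * a = a * (x * y + y * x)" "\<And>c. \<kappa> c * a = a * \<kappa> c"
  shows "w * a = a * w"
  unfolding w_def by (metis assms mult.assoc)

text \<open>Multiplying \<open>x * y + y * x\<close> by \<open>x\<close> on either side gives
  \<open>x * y * x\<close> plus a term with \<open>x * x\<close>, and \<open>x * x\<close> commutes
  with \<open>y\<close>; the case of \<open>y\<close> is symmetric. Past \<open>z\<close>, each
  product of two letters changes sign twice.\<close>

lemma w_commute: "w * x = x * w" "w * y = y * w" "w * z = z * w" "\<kappa> c * w = w * \<kappa> c"
proof -
  show "w * x = x * w"
    using xxy by (intro w_commute_if kx) (simp add: distrib_left distrib_right mult.assoc)
  show "w * y = y * w"
    using yyx by (intro w_commute_if ky) (simp add: distrib_left distrib_right mult.assoc)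
  have "x * y * z = z * (x * y)" "y * x * z = z * (y * x)"
    by (metis xz yz mult.assoc minus_mult_left minus_mult_right minus_minus)+
  then show "w * z = z * w"
    by (intro w_commute_if kz) (simp add: distrib_left distrib_right)
  have "\<kappa> c * (x * y) = x * y * \<kappa> c" "\<kappa> c * (y * x) = y * x * \<kappa> c"
    by (metis kx ky mult.assoc)+
  moreover have "\<kappa> c * \<kappa> d = \<kappa> d * \<kappa> c" for d
    by (simp add: mult.commute flip: hom_mult)
  ultimately show "\<kappa> c * w = w * \<kappa> c"
    by (intro w_commute_if[symmetric]) (simp_all add: distrib_left distrib_right)
qed

definition monom_eval :: "(3 \<Rightarrow>\<^sub>0 nat) \<Rightarrow> 'a" where
  "monom_eval m = (x * x) ^ Poly_Mapping.lookup m 1 * (y * y) ^ Poly_Mapping.lookup m 2 * w ^ Poly_Mapping.lookup m 3"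

lemma monom_eval_commute:
  assumes "x * x * a = a * (x * x)" "y * y * a = a * (y * y)" "w * a = a * w"
  shows "monom_eval m * a = a * monom_eval m"
proof -
  have "(x * x) ^ i * a = a * (x * x) ^ i" "(y * y) ^ i * a = a * (y * y) ^ i" "w ^ i * a = a * w ^ i" for i
    using assms by (simp_all add: power_commuting_commutes)
  moreover have "A * B * C * a = a * (A * B * C)" if "A * a = a * A" "B * a = a * B" "C * a = a * C" for A B C
    using that by (metis mult.assoc)
  ultimately show ?thesis
    unfolding monom_eval_def by blast
qed

text \<open>The elements \<open>x * x\<close>, \<open>y * y\<close> and \<open>w\<close> commute
  pairwise, so products of their powers can be regrouped and polynomials in three variables can be
  evaluated at them. This provides the \<open>poly3\<close>-algebra structure.\<close>

sublocale poly: monoid_algebra_eval \<kappa> monom_eval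
proof
  show "monom_eval 0 = 1"
    by (simp add: monom_eval_def)
  show "\<kappa> c * monom_eval m = monom_eval m * \<kappa> c" for c m
    using xx_commute(4) yy_commute(4) w_commute(4) by (intro monom_eval_commute[symmetric]) simp_all
  show "monom_eval (k + l) = monom_eval k * monom_eval l" for k l
  proof -
    have xy: "(y * y) ^ i * (x * x) ^ j = (x * x) ^ j * (y * y) ^ i" for i j
      by (intro power_commuting_commutes power_commuting_commutes[symmetric]) (metis xxy mult.assoc)
    have xw: "w ^ i * (x * x) ^ j = (x * x) ^ j * w ^ i" for i j
      by (intro power_commuting_commutes power_commuting_commutes[symmetric]) (metis w_commute(1) mult.assoc)
    have yw: "w ^ i * (y * y) ^ j = (y * y) ^ j * w ^ i" for i j
      by (intro power_commuting_commutes power_commuting_commutes[symmetric]) (metis w_commute(2) mult.assoc)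
    have swap: "(a * b * c) * (a' * b' * c') = a * a' * (b * b') * (c * c')"
      if "b * a' = a' * b" "c * a' = a' * c" "c * b' = b' * c" for a b c a' b' c' :: 'a
      by (metis that mult.assoc)
    show ?thesis
      unfolding monom_eval_def lookup_add power_add
      by (rule swap[symmetric]) (rule xy xw yw)+
  qed
qed

abbreviation "pev \<equiv> poly.ev"

sublocale pev: unital_ring_hom pev
  by (rule poly.ev_hom)

lemma pev_const: "pev (alg_const c) = \<kappa> c"
  by (simp add: alg_const_def poly.ev_alg_const)

lemma pev_pvar: "pev (pvar 1) = x * x" "pev (pvar 2) = y * y" "pev (pvar 3) = w"
  by (simp_all add: pvar_def poly.ev_single hom_one monom_eval_def lookup_single)

text \<open>Applied to \<open>x\<close>, \<open>y\<close> and \<open>z\<close>, this is the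
  centrality of scalars that a map out of a Clifford algebra over \<open>poly3\<close>
  presupposes.\<close>

lemma pev_commute:
  assumes "x * x * a = a * (x * x)" "y * y * a = a * (y * y)" "w * a = a * w" "\<And>c. \<kappa> c * a = a * \<kappa> c"
  shows "pev p * a = a * pev p"
proof (induction p rule: poly_mapping_add_induct)
  case (single k c)
  show ?case
    unfolding poly.ev_single by (metis monom_eval_commute[OF assms(1-3)] assms(4) mult.assoc)
qed (simp add: pev.hom_add distrib_left distrib_right)

definition vec_elem :: "3 \<Rightarrow> 'a" where
  "vec_elem i = (if i = 1 then x else if i = 2 then y else z)"

lemma vec_elem_simps: "vec_elem 1 = x" "vec_elem 2 = y" "vec_elem 3 = z"
  by (simp_all add: vec_elem_def)

text \<open>Off the third row and column the entries are the values chosen for the variables; the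
  others express \<open>z * z = 1\<close> and the two anticommutation rules with \<open>z\<close>.
  The Clifford algebra therefore maps to the ring at hand.\<close>

sublocale clifford_eval pev conifold_matrix vec_elem
proof
  have "\<forall>i. pev p * vec_elem i = vec_elem i * pev p" for p
    unfolding forall_3 vec_elem_simps
    by (intro conjI pev_commute xx_commute yy_commute w_commute kx ky kz)
  then show "pev p * vec_elem i = vec_elem i * pev p" for p i
    by blast
  have two: "pev (2 * p) = pev p + pev p" for p
    by (simp only: mult_2 pev.hom_add)
  have "\<forall>i j. vec_elem i * vec_elem j + vec_elem j * vec_elem i = pev (2 * conifold_matrix $ i $ j)"
    unfolding forall_3 vec_elem_simps two
    by (simp add: pev_pvar pev.hom_one pev.hom_zero w_add zz xz yz add.commute)
  then show "vec_elem i * vec_elem j + vec_elem j * vec_elem i = pev (2 * conifold_matrix $ i $ j)" for i j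
    by blast
qed

end

section \<open>The maps in both directions, on the level of free algebras\<close>

interpretation cc: unital_ring_hom conifold_class
  by (rule conifold_class_hom)

interpretation ac: unital_ring_hom "alg_const :: 'r::comm_ring_1 \<Rightarrow> ('m::monoid_add \<Rightarrow>\<^sub>0 'r)"
  by (rule alg_const_hom)

lemma conifold_class_relation: "r \<in> conifold_relations \<Longrightarrow> conifold_class r = 0"
  using conifold_relations_subset by (auto simp: conifold_class_eq_zero_iff)

interpretation con: conifold_elements "\<lambda>c. conifold_class (alg_const c)"
  "conifold_class (gen GX)" "conifold_class (gen GY)" "conifold_class (gen GZ)"
proof
  let ?x = "conifold_class (gen GX)" and ?y = "conifold_class (gen GY)" and ?z = "conifold_class (gen GZ)"
  have comm: "conifold_class (alg_const c) * conifold_class (gen g) =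
      conifold_class (gen g) * conifold_class (alg_const c)"
    for c g
    by (metis alg_const_commute cc.hom_mult)
  show "conifold_class (alg_const c) * ?x = ?x * conifold_class (alg_const c)"
    "conifold_class (alg_const c) * ?y = ?y * conifold_class (alg_const c)"
    "conifold_class (alg_const c) * ?z = ?z * conifold_class (alg_const c)" for c
    by (rule comm)+
  have rel: "conifold_class r = 0"
    if "r \<in> {(gen GZ)\<^sup>2 - 1, gen GX * gen GZ + gen GZ * gen GX, gen GY * gen GZ + gen GZ * gen GY,
      commutator ((gen GX)\<^sup>2) (gen GY), commutator ((gen GY)\<^sup>2) (gen GX)}" for r
    using conifold_class_relation[of r] that by (simp add: conifold_relations_def Let_def)
  show "?z * ?z = 1"
    using rel[of "(gen GZ)\<^sup>2 - 1"] by (simp add: cc.hom_simps power2_eq_square)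
  show "?x * ?z = - (?z * ?x)"
    using rel[of "gen GX * gen GZ + gen GZ * gen GX"] by (simp add: cc.hom_simps eq_neg_iff_add_eq_0)
  show "?y * ?z = - (?z * ?y)"
    using rel[of "gen GY * gen GZ + gen GZ * gen GY"] by (simp add: cc.hom_simps eq_neg_iff_add_eq_0)
  show "?x * ?x * ?y = ?y * (?x * ?x)"
    using rel[of "commutator ((gen GX)\<^sup>2) (gen GY)"]
    by (simp add: cc.hom_simps commutator_def power2_eq_square)
  show "?y * ?y * ?x = ?x * (?y * ?y)"
    using rel[of "commutator ((gen GY)\<^sup>2) (gen GX)"]
    by (simp add: cc.hom_simps commutator_def power2_eq_square)
qed (simp_all add: ac.hom_simps cc.hom_simps)

text \<open>Constants are embedded twice: a complex number becomes a constant polynomial, which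
  becomes a constant of the free algebra on vectors.\<close>

interpretation phi: free_algebra_eval
  "\<lambda>c. alg_const (alg_const c) :: (poly3, poly3^3) free_algebra" "\<lambda>g. gen (axis (gen_index g) 1)"
  by unfold_locales (simp_all add: ac.hom_simps, rule alg_const_commute)

text \<open>Both sides are ring homomorphisms that agree on constants and generators. Going over and
  back is thus the class map, which will give injectivity.\<close>

lemma fev_phi: "con.fev (phi.fev a) = conifold_class a"
proof (induction a rule: free_algebra_induct)
  case (const r)
  then show ?case by (simp add: phi.fev_const con.fev_const con.pev_const)
next
  case (gen g)
  then show ?case
    by (cases g) (simp_all add: phi.fev_gen con.fev_gen con.lin_axis con.vec_elem_simps)
qed (simp_all add: phi.fev.hom_simps con.fev.hom_simps cc.hom_simps)

section \<open>The homomorphism to the Clifford algebra, its kernel and its image\<close>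

definition conifold_to_clifford ::
  "(complex, conifold_gen) free_algebra \<Rightarrow> (poly3, poly3^3) free_algebra set set" where
  "conifold_to_clifford a = clifford_class conifold_matrix (phi.fev a)"

lemma conifold_to_clifford_hom:
  "ring_hom_ring ring_of_type_algebra (clifford_algebra conifold_matrix) conifold_to_clifford"
proof (rule ring_hom_ringI2[OF ring_ring_of_type_algebra ring_clifford_algebra])
  have "phi.fev \<in> ring_hom ring_of_type_algebra ring_of_type_algebra"
    by (rule ring_hom_memI) (simp_all add: phi.fev.hom_simps)
  from ring_hom_trans[OF this ring_hom_ring.homh[OF clifford_class_hom]]
  show "conifold_to_clifford \<in> ring_hom ring_of_type_algebra (clifford_algebra conifold_matrix)"
    by (simp add: conifold_to_clifford_def[abs_def] comp_def)
qed

lemma half_add_half: "alg_const (1/2) + alg_const (1/2) = (1 :: poly3)"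
  by (simp add: ac.hom_one flip: ac.hom_add)

text \<open>The relations in \<open>GZ\<close> without commutators come from the entries of the
  third column. The two commutators vanish because the square of a basis vector is a scalar, and
  scalars are central.\<close>

lemma conifold_to_clifford_relation:
  assumes "r \<in> conifold_relations"
  shows "conifold_to_clifford r = \<zero>\<^bsub>clifford_algebra conifold_matrix\<^esub>"
proof -
  let ?c = "clifford_class conifold_matrix"
  let ?e = "\<lambda>i. gen (axis i 1) :: (poly3, poly3^3) free_algebra"
  have eq: "?c a = \<zero>\<^bsub>clifford_algebra conifold_matrix\<^esub>" if "?c u = ?c v" "a = u - v" for a u v
    using that by (simp add: clifford_class_eq_iff)
  have square: "?c (?e i * ?e i) = ?c (alg_const (conifold_matrix $ i $ i))" for i
    using clifford_class_square[OF half_add_half, of conifold_matrix "axis i 1"]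
    by (simp add: bilin_form_axis)
  have anti: "?c (?e i * ?e j + ?e j * ?e i) = ?c (alg_const (2 * conifold_matrix $ i $ j))" for i j
    by (simp add: clifford_class_anticommutator bilin_form_axis)
  have comm: "?c (?e i * ?e i * ?e j) = ?c (?e j * (?e i * ?e i))" for i j
  proof -
    have "?c (?e i * ?e i * ?e j) = ?c (alg_const (conifold_matrix $ i $ i) * ?e j)"
      by (metis clifford_class_mult square)
    also have "\<dots> = ?c (?e j * alg_const (conifold_matrix $ i $ i))"
      by (rule arg_cong[OF alg_const_commute])
    also have "\<dots> = ?c (?e j * (?e i * ?e i))"
      by (simp only: clifford_class_mult[of _ "?e j"] square)
    finally show ?thesis .
  qed
  have "phi.fev r \<in> {?e 3 * ?e 3 - 1, ?e 1 * ?e 3 + ?e 3 * ?e 1, ?e 2 * ?e 3 + ?e 3 * ?e 2,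
      ?e 1 * ?e 1 * ?e 2 - ?e 2 * (?e 1 * ?e 1), ?e 2 * ?e 2 * ?e 1 - ?e 1 * (?e 2 * ?e 2)}"
    using assms
    by (auto simp: conifold_relations_def Let_def commutator_def power2_eq_square
        phi.fev.hom_simps phi.fev_gen)
  then show ?thesis
    unfolding conifold_to_clifford_def
    using eq[OF square[of 3]] eq[OF anti[of 1 3]] eq[OF anti[of 2 3]] eq[OF comm[of 1 2]] eq[OF comm[of 2 1]]
    by (auto simp: ac.hom_simps)
qed

text \<open>An element with zero Clifford class is killed by the map back, and by
  \<open>fev_phi\<close> its conifold class is then zero. Conversely, the generators of
  \<open>conifold_ideal\<close> are sent to zero.\<close>

lemma kernel_conifold_to_clifford:
  "a_kernel ring_of_type_algebra (clifford_algebra conifold_matrix) conifold_to_clifford = conifold_ideal"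
proof -
  interpret h: ring_hom_ring ring_of_type_algebra "clifford_algebra conifold_matrix" conifold_to_clifford
    by (rule conifold_to_clifford_hom)
  show ?thesis
  proof
    show "a_kernel ring_of_type_algebra (clifford_algebra conifold_matrix) conifold_to_clifford \<subseteq> conifold_ideal"
    proof
      fix a assume "a \<in> a_kernel ring_of_type_algebra (clifford_algebra conifold_matrix) conifold_to_clifford"
      then have "con.fev (phi.fev a) = 0"
        by (intro con.fev_eq_zero) (simp add: a_kernel_def' conifold_to_clifford_def)
      then show "a \<in> conifold_ideal"
        by (simp add: fev_phi conifold_class_eq_zero_iff)
    qed
    show "conifold_ideal \<subseteq> a_kernel ring_of_type_algebra (clifford_algebra conifold_matrix) conifold_to_clifford"
      unfolding conifold_ideal_def
    proof (rule type_ring.genideal_minimal[OF h.kernel_is_ideal])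
      show "conifold_relations \<subseteq> a_kernel ring_of_type_algebra (clifford_algebra conifold_matrix) conifold_to_clifford"
        using conifold_to_clifford_relation unfolding a_kernel_def' ring_of_type_algebra_simps by blast
    qed
  qed
qed

text \<open>The classes that are reached form a subring. It contains the complex constants and the
  basis vectors, then the variables as half anticommutators, then all polynomial scalars, and
  finally all vectors, which together generate everything.\<close>

lemma range_conifold_to_clifford: "range conifold_to_clifford = carrier (clifford_algebra conifold_matrix)"
proof -
  let ?c = "clifford_class conifold_matrix"
  define P where "P b \<longleftrightarrow> (\<exists>a. ?c b = conifold_to_clifford a)" for b
  \<comment> \<open>Only classes matter for \<open>P\<close>, so Clifford relations may be used to
    replace its argument.\<close>
  have cong: "P b \<longleftrightarrow> P b'" if "?c b = ?c b'" for b b'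
    using that by (simp add: P_def)
  have phi: "P (phi.fev a)" for a
    unfolding P_def conifold_to_clifford_def by blast
  have add: "P (b + b')" if "P b" "P b'" for b b'
    using that unfolding P_def conifold_to_clifford_def
    by (metis clifford_class_add phi.fev.hom_add)
  have mult: "P (b * b')" if "P b" "P b'" for b b'
    using that unfolding P_def conifold_to_clifford_def
    by (metis clifford_class_mult phi.fev.hom_mult)
  have const: "P (alg_const (alg_const k))" for k
    using phi[of "alg_const k"] by (simp add: phi.fev_const)
  have axis: "P (gen (axis i 1))" for i
    using phi[of "gen GX"] phi[of "gen GY"] phi[of "gen GZ"] exhaust_3[of i] by (auto simp: phi.fev_gen)
  have entry: "P (alg_const (conifold_matrix $ i $ j))" for i j
    using clifford_class_half_anticommutator[OF half_add_half, of conifold_matrix "axis i 1" "axis j 1"]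
      mult[OF const add[OF mult[OF axis axis] mult[OF axis axis]]]
    by (metis cong bilin_form_axis)
  have pow: "P (alg_const (p ^ n))" if "P (alg_const p)" for p n
  proof (induction n)
    case 0
    then show ?case using const[of 1] by (simp add: ac.hom_one)
  next
    case (Suc n)
    then show ?case using mult[OF that] by (simp add: ac.hom_mult)
  qed
  have scalar: "P (alg_const p)" for p
  proof (induction p rule: poly_mapping_add_induct)
    case (single m k)
    \<comment> \<open>The three variables occur as the matrix entries at (1,1), (2,2) and
      (1,2).\<close>
    have "P (alg_const (pvar i))" for i
      using entry[of 1 1] entry[of 2 2] entry[of 1 2] exhaust_3[of i] by auto
    then show ?case
      unfolding single_eq_pvar_prod ac.hom_mult by (intro mult const pow)
  qed (simp add: add ac.hom_add)
  have "P b" for b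
  proof (induction b rule: free_algebra_induct)
    case (gen v)
    \<comment> \<open>A vector is a letter of the free algebra, so it has to be decomposed along the
      basis by means of the tensor relations.\<close>
    have smult: "P (gen (r *s axis i 1))" for r i
      using mult[OF scalar axis] cong[OF clifford_class_gen_smult] by blast
    have "P (gen (v $ 1 *s axis 1 1 + v $ 2 *s axis 2 1 + v $ 3 *s axis 3 1))"
      using smult add cong[OF clifford_class_gen_add] by blast
    then show ?case
      using basis_expansion[of v] by (simp add: sum_3)
  qed (auto intro: scalar add mult)
  then have "range ?c \<subseteq> range conifold_to_clifford"
    unfolding P_def by (metis image_subsetI rangeI)
  moreover have "range conifold_to_clifford \<subseteq> range ?c"
    by (auto simp: conifold_to_clifford_def)
  ultimately show ?thesis
    unfolding range_clifford_class[symmetric] by blast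
qed

theorem lemma5p3:
  shows "\<exists>M :: poly3^3^3. symmetric_matrix M \<and> nondegenerate M \<and>
    algebra_isomorphic conifold_algebra conifold_scalar
      (clifford_algebra M) (\<lambda>c. clifford_scalar M (alg_const c))"
proof (intro exI conjI)
  interpret h: ring_hom_ring ring_of_type_algebra "clifford_algebra conifold_matrix" conifold_to_clifford
    by (rule conifold_to_clifford_hom)
  \<comment> \<open>The homomorphism is constant on each coset of its kernel, so the image of a
    coset has exactly one element.\<close>
  let ?f = "\<lambda>A. the_elem (conifold_to_clifford ` A)"
  \<comment> \<open>First isomorphism theorem: by the computed kernel, the quotient by it is
    \<open>conifold_algebra\<close> itself.\<close>
  have iso: "?f \<in> ring_iso conifold_algebra (clifford_algebra conifold_matrix)"
    using h.FactRing_iso_set[unfolded ring_of_type_algebra_simps, OF range_conifold_to_clifford]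
    unfolding kernel_conifold_to_clifford conifold_algebra_def quot_ring_def conifold_ideal_def .
  have scal: "?f (conifold_scalar k) = clifford_scalar conifold_matrix (alg_const k)" for k
  proof -
    have "?f (conifold_scalar k) = conifold_to_clifford (alg_const k)"
      using h.the_elem_simp[unfolded ring_of_type_algebra_simps, OF UNIV_I, of "alg_const k"]
      unfolding kernel_conifold_to_clifford conifold_scalar_def quot_class_def conifold_ideal_def .
    also have "\<dots> = clifford_scalar conifold_matrix (alg_const k)"
      by (simp add: conifold_to_clifford_def phi.fev_const clifford_class_alg_const)
    finally show ?thesis .
  qed
  show "algebra_isomorphic conifold_algebra conifold_scalar
      (clifford_algebra conifold_matrix) (\<lambda>c. clifford_scalar conifold_matrix (alg_const c))"
    unfolding algebra_isomorphic_def by (rule bexI[OF _ iso], rule allI, rule scal)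
qed (rule symmetric_conifold_matrix nondegenerate_conifold_matrix)+

end
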